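(* Let $k\ge 3$ and $n\ge k$ be integers, and let $G$ be the complete $k$-uniform hypergraph with $n$ vertices. Then the tensor entropy of $G$ is $$S_c=\frac{(1-n)\alpha}{(n-1)\alpha+\beta}\ln\frac{\alpha}{(n-1)\alpha+\beta}-\frac{\beta}{(n-1)\alpha+\beta}\ln\frac{\beta}{(n-1)\alpha+\beta},$$ where $$\alpha=\left(\frac{\Gamma(n)\big(\Gamma(n-k+1)+\Gamma(n)\big)}{\Gamma(k)^2\,\Gamma(n-k+1)^2}-\frac{\Gamma(n-1)}{\Gamma(k)^2\,\Gamma(n-k)}\right)^{1/2},$$ $$\beta=\left(\frac{\Gamma(n)\big(\Gamma(n-k+1)+\Gamma(n)\big)}{\Gamma(k)^2\,\Gamma(n-k+1)^2}+\frac{(n-1)\Gamma(n-1)}{\Gamma(k)^2\,\Gamma(n-k)}\right)^{1/2},$$ and $\Gamma$ is the Gamma function, with the convention $1/\Gamma(0)=0$ (used when $n=k$).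
   Context: A $k$-uniform hypergraph $G=(V,E)$ with $n$ vertices has $V=\{1,\dots,n\}$ and $E$ a set of $k$-element subsets of $V$ (the hyperedges). $G$ is complete if $E$ consists of all $k$-element subsets of $V$. Its adjacency tensor $A\in\mathbb{R}^{n\times\cdots\times n}$ (order $k$) has entries $A_{j_1\dots j_k}=\frac{1}{(k-1)!}$ if $j_1,\dots,j_k$ are distinct and $\{j_1,\dots,j_k\}\in E$, and $0$ otherwise. Its degree tensor $D$ (order $k$, dimension $n$) is diagonal, with $D_{jj\dots j}$ equal to the number of hyperedges containing vertex $j$ and all other entries $0$. The Laplacian tensor is $L=D-A$. The $k$-mode unfolding $L_{(k)}\in\mathbb{R}^{n\times n^{k-1}}$ is the matrix whose rows are indexed by $j_k$ and columns by $(j_1,\dots,j_{k-1})$, with entry $L_{j_1\dots j_k}$ (since $L$ is invariant under permutations of its indices, unfolding along any mode gives the same matrix). The $k$-mode singular values $\gamma_1,\dots,\gamma_n\ge 0$ of $L$ are the $n$ singular values of $L_{(k)}$, i.e. the square roots of the eigenvalues of $L_{(k)}L_{(k)}^\top\in\mathbb{R}^{n\times n}$, counted with multiplicity. For $E\neq\emptyset$, the tensor entropy of $G$ is $S(G)=-\sum_{j=1}^n\hat\gamma_j\ln\hat\gamma_j$, where $\hat\gamma_j=\gamma_j/\sum_{i=1}^n\gamma_i$ and $0\ln 0=0$. *)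

theory Defs
  imports
    "HOL-Analysis.Gamma_Function"
    "Jordan_Normal_Form.Char_Poly"
begin

definition uniform_hypergraph :: "nat \<Rightarrow> nat \<Rightarrow> nat set set \<Rightarrow> bool" where
  "uniform_hypergraph n k E \<longleftrightarrow> (\<forall>e\<in>E. e \<subseteq> {1..n} \<and> card e = k)"

definition complete_uniform_hypergraph :: "nat \<Rightarrow> nat \<Rightarrow> nat set set \<Rightarrow> bool" where
  "complete_uniform_hypergraph n k E \<longleftrightarrow>
     uniform_hypergraph n k E \<and> (\<forall>e. e \<subseteq> {1..n} \<and> card e = k \<longrightarrow> e \<in> E)"

text \<open>
  A tensor of order \<open>k\<close> and dimension \<open>n\<close> is a function on index lists
  \<open>[j\<^sub>1, \<dots>, j\<^sub>k]\<close> with entries in \<open>{1..n}\<close>; its values on other lists are never used.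
\<close>

definition adjacency_tensor :: "nat \<Rightarrow> nat set set \<Rightarrow> nat list \<Rightarrow> real" where
  "adjacency_tensor k E js = (if distinct js \<and> set js \<in> E then 1 / fact (k - 1) else 0)"

definition degree_tensor :: "nat \<Rightarrow> nat set set \<Rightarrow> nat list \<Rightarrow> real" where
  "degree_tensor k E js =
     (if js = replicate k (hd js) then real (card {e \<in> E. hd js \<in> e}) else 0)"

definition laplacian_tensor :: "nat \<Rightarrow> nat set set \<Rightarrow> nat list \<Rightarrow> real" where
  "laplacian_tensor k E js = degree_tensor k E js - adjacency_tensor k E js"

text \<open>
  Matrix rows and columns are numbered from 0: row \<open>r\<close> stands for \<open>j\<^sub>k = r + 1\<close>, and column
  \<open>c < n ^ (k - 1)\<close> for the tuple \<open>(j\<^sub>1, \<dots>, j\<^sub>k\<^sub>-\<^sub>1)\<close> with \<open>c = (\<Sum>l = 1..k-1. (j\<^sub>l - 1) * n ^ (l - 1))\<close>,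
  so that every tuple over \<open>{1..n}\<close> occurs exactly once.
\<close>

definition mode_unfolding :: "nat \<Rightarrow> nat \<Rightarrow> (nat list \<Rightarrow> real) \<Rightarrow> real mat" where
  "mode_unfolding n k T =
     mat n (n ^ (k - 1)) (\<lambda>(r, c). T (map (\<lambda>l. c div n ^ l mod n + 1) [0..<k - 1] @ [r + 1]))"

text \<open>
  \<open>M M\<^sup>T\<close> is real symmetric, so its characteristic polynomial splits over the reals and
  the multiset below has exactly \<open>dim_row M\<close> elements.
\<close>

definition singular_values :: "real mat \<Rightarrow> real multiset" where
  "singular_values M = image_mset sqrt (proots (char_poly (M * transpose_mat M)))"

text \<open>The convention \<open>0 ln 0 = 0\<close> holds automatically: \<open>ln\<close> is total and \<open>0 * x = 0\<close>.\<close>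

definition tensor_entropy :: "nat \<Rightarrow> nat \<Rightarrow> nat set set \<Rightarrow> real" where
  "tensor_entropy n k E =
     (let \<gamma> = singular_values (mode_unfolding n k (laplacian_tensor k E))
      in - (\<Sum>g\<in>#\<gamma>. g / sum_mset \<gamma> * ln (g / sum_mset \<gamma>)))"

text \<open>
  The convention \<open>1 / \<Gamma>(0) = 0\<close> is that of the library: \<^const>\<open>Gamma\<close> is \<open>0\<close> at its poles, and
  division by \<open>0\<close> yields \<open>0\<close>.
\<close>

lemma inverse_Gamma_0: "1 / Gamma (0::real) = 0"
  by simp

end

theory Submission imports Defs begin

text \<open>
  For \<open>k \<ge> 3\<close> the off-diagonal entries of \<open>L\<^sub>(\<^sub>k\<^sub>) L\<^sub>(\<^sub>k\<^sub>)\<^sup>T\<close> receive no contribution from the degree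
  tensor, so this matrix equals \<open>(a - b) I + b J\<close>, where \<open>J\<close> is the all-ones matrix,
  \<open>a = d\<^sup>2 + d / (k-1)!\<close> with \<open>d\<close> the common vertex degree, and \<open>b\<close> is \<open>1 / (k-1)!\<^sup>2\<close> times the
  number of injective \<open>(k-1)\<close>-tuples avoiding two given vertices. Its eigenvalues are \<open>a - b\<close>, with multiplicity
  \<open>n - 1\<close>, and \<open>a + (n - 1) b\<close>.
\<close>

section \<open>Spectrum of \<open>(a - b) I + b J\<close>\<close>

lemma mult_mat_index_sum:
  assumes "A \<in> carrier_mat nr n" "B \<in> carrier_mat n nc" "i < nr" "j < nc"
  shows "(A * B) $$ (i, j) = (\<Sum>l<n. A $$ (i, l) * B $$ (l, j))"
  using assms by (auto simp: scalar_prod_def lessThan_atLeast0 intro!: sum.cong)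

text \<open>
  In the basis \<open>(1, \<dots>, 1), e\<^sub>1, \<dots>, e\<^sub>n\<^sub>-\<^sub>1\<close> the matrix becomes upper triangular.
\<close>

lemma char_poly_const_diag_off_diag:
  fixes a b :: "'a :: comm_ring_1"
  assumes n: "n > 0"
  shows "char_poly (mat n n (\<lambda>(i, j). if i = j then a else b)) =
           [:- (a + of_nat (n - 1) * b), 1:] * [:- (a - b), 1:] ^ (n - 1)"
proof -
  define M where "M = mat n n (\<lambda>(i, j). if i = j then a else b)"
  \<comment> \<open>Column 0 records that the all-ones vector is an eigenvector, with eigenvalue the
    row sum. Column j > 0 records that the unit vector \<open>e_j\<close> is sent to (a - b)
    \<open>e_j\<close> plus b times the all-ones vector.\<close>
  define U where "U = mat n n (\<lambda>(i, j). if i = 0 then (if j = 0 then a + of_nat (n - 1) * b else b)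
                                        else if i = j then a - b else 0)"
  define P :: "'a mat" where "P = mat n n (\<lambda>(i, j). if i = j \<or> j = 0 then 1 else 0)"
  \<comment> \<open>The entries -1 express \<open>e_0\<close> in the new basis: it is the all-ones
    vector minus the other unit vectors.\<close>
  define Q :: "'a mat" where
    "Q = mat n n (\<lambda>(i, j). if i = j then 1 else if j = 0 then - 1 else 0)"
  have carr: "M \<in> carrier_mat n n" "U \<in> carrier_mat n n" "P \<in> carrier_mat n n" "Q \<in> carrier_mat n n"
    by (simp_all add: M_def U_def P_def Q_def)
  \<comment> \<open>Index 0 is split off because only there do the change-of-basis matrices differ
    from the identity; the remaining sums are single delta terms.\<close>
  have split0: "(\<Sum>l<n. f l) = f 0 + (\<Sum>l\<in>{1..<n}. f l)" for f :: "nat \<Rightarrow> 'a"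
    using n by (simp add: lessThan_atLeast0 sum.atLeast_Suc_lessThan)
  have PQ: "P * Q = 1\<^sub>m n"
  proof (rule eq_matI)
    fix i j assume ij: "i < dim_row (1\<^sub>m n :: 'a mat)" "j < dim_col (1\<^sub>m n :: 'a mat)"
    have "(P * Q) $$ (i, j) = Q $$ (0, j) + (\<Sum>l\<in>{1..<n}. if l = i then Q $$ (l, j) else 0)"
      using ij n unfolding mult_mat_index_sum[OF carr(3,4) ij[simplified]] split0
      by (intro arg_cong2[where f = "(+)"] sum.cong) (auto simp: P_def)
    then show "(P * Q) $$ (i, j) = 1\<^sub>m n $$ (i, j)"
      using ij n by (auto simp: Q_def)
  qed (use carr in auto)
  have QP: "Q * P = 1\<^sub>m n"
  proof (rule eq_matI)
    fix i j assume ij: "i < dim_row (1\<^sub>m n :: 'a mat)" "j < dim_col (1\<^sub>m n :: 'a mat)"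
    have "(Q * P) $$ (i, j) = Q $$ (i, 0) * P $$ (0, j) + (\<Sum>l\<in>{1..<n}. if l = i then P $$ (l, j) else 0)"
      using ij n unfolding mult_mat_index_sum[OF carr(4,3) ij[simplified]] split0
      by (intro arg_cong2[where f = "(+)"] sum.cong) (auto simp: P_def Q_def)
    then show "(Q * P) $$ (i, j) = 1\<^sub>m n $$ (i, j)"
      using ij n by (auto simp: P_def Q_def)
  qed (use carr in auto)
  have MP: "M * P = P * U"
  proof (rule eq_matI)
    fix i j assume "i < dim_row (P * U)" "j < dim_col (P * U)"
    then have ij: "i < n" "j < n" using carr by auto
    have 1: "(P * U) $$ (i, j) = U $$ (0, j) + (\<Sum>l\<in>{1..<n}. if l = i then U $$ (l, j) else 0)"
      using ij n unfolding mult_mat_index_sum[OF carr(3,2) ij] split0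
      by (intro arg_cong2[where f = "(+)"] sum.cong) (auto simp: P_def)
    have 2: "(M * P) $$ (i, j) =
        (if j = 0 then (\<Sum>l<n. M $$ (i, l)) else (\<Sum>l<n. if l = j then M $$ (i, l) else 0))"
      using ij n unfolding mult_mat_index_sum[OF carr(1,3) ij]
      by (auto simp: P_def mult_delta_right)
    have 3: "(\<Sum>l<n. M $$ (i, l)) = a + of_nat (n - 1) * b"
      using ij by (simp add: M_def sum.remove[of "{..<n}" i] card_Diff_singleton)
    show "(M * P) $$ (i, j) = (P * U) $$ (i, j)"
      unfolding 1 2 3 using ij n by (auto simp: U_def M_def)
  qed (use carr in auto)
  have "M = M * (P * Q)" using carr by (simp add: PQ)
  also have "\<dots> = P * U * Q" unfolding MP[symmetric] by (rule assoc_mult_mat[symmetric]) (use carr in auto)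
  finally have "similar_mat M U"
    using carr PQ QP by (intro similar_matI[of M U P Q n]) auto
  then have "char_poly M = char_poly U" by (rule char_poly_similar)
  also have "\<dots> = (\<Prod>x\<leftarrow>diag_mat U. [:- x, 1:])"
    using carr(2) by (rule char_poly_upper_triangular) (auto simp: U_def)
  also have "diag_mat U = (a + of_nat (n - 1) * b) # replicate (n - 1) (a - b)"
    using n by (auto simp: diag_mat_def U_def list_eq_iff_nth_eq nth_Cons split: nat.split)
  finally show ?thesis by (simp add: M_def prod_list_replicate)
qed

lemma singular_values_const_diag_off_diag:
  assumes "n > 0" "M * transpose_mat M = mat n n (\<lambda>(i, j). if i = j then a else b)"
  shows "singular_values M =
           add_mset (sqrt (a + (real n - 1) * b)) (replicate_mset (n - 1) (sqrt (a - b)))"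
proof -
  have rep: "repeat_mset m {#x#} = replicate_mset m x" for m and x :: real
    by (induction m) auto
  have roots: "proots ([:- p, 1:] * [:- q, 1:] ^ m) = add_mset p (replicate_mset m q)"
    for p q :: real and m
    by (subst proots_mult) (auto simp: proots_power rep)
  show ?thesis
    unfolding singular_values_def assms(2) char_poly_const_diag_off_diag[OF assms(1)] roots
    using assms(1) by (simp add: of_nat_diff)
qed

section \<open>Gram matrix of the unfolding as a sum over tuples\<close>

text \<open>The column number is read in base n, lowest digit first, with digits shifted to 1..n.
  Stripping the lowest digit gives injectivity by induction; surjectivity follows because both sides
  have \<open>n ^ m\<close> elements.\<close>

lemma bij_betw_digits:
  fixes n m :: nat
  assumes n: "n > 0"
  shows "bij_betw (\<lambda>c. map (\<lambda>l. c div n ^ l mod n + 1) [0..<m]) {..<n ^ m}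
           {xs. set xs \<subseteq> {1..n} \<and> length xs = m}" (is "bij_betw (?f m) _ (?B m)")
proof -
  have inj: "inj_on (?f m) {..<n ^ m}"
  proof (induction m)
    case (Suc m)
    show ?case
    proof (rule inj_onI)
      fix c c' assume cs: "c \<in> {..<n ^ Suc m}" "c' \<in> {..<n ^ Suc m}" and eq: "?f (Suc m) c = ?f (Suc m) c'"
      have mem: "x div n \<in> {..<n ^ m}" if "x \<in> {..<n ^ Suc m}" for x
        using that less_mult_imp_div_less[of x "n ^ m" n] by (simp add: mult.commute)
      have step: "?f (Suc m) x = (x mod n + 1) # ?f m (x div n)" for x
        by (simp only: upt_conv_Cons[OF zero_less_Suc] list.map map_Suc_upt[symmetric] map_map o_def)
          (simp add: div_mult2_eq)
      have "c mod n = c' mod n" "c div n = c' div n"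
        using eq inj_onD[OF Suc.IH _ mem[OF cs(1)] mem[OF cs(2)]] unfolding step by simp_all
      then show "c = c'" by (metis div_mult_mod_eq)
    qed
  qed (auto simp: inj_on_def)
  have "?f m ` {..<n ^ m} = ?B m"
  proof (rule card_subset_eq)
    show "finite (?B m)" by (rule finite_lists_length_eq) simp
    show "?f m ` {..<n ^ m} \<subseteq> ?B m"
      using n by (auto simp: Suc_le_eq)
    show "card (?f m ` {..<n ^ m}) = card (?B m)"
      unfolding card_image[OF inj] by (simp add: card_lists_length_eq)
  qed
  then show ?thesis using inj by (simp add: bij_betw_def)
qed

text \<open>Reindexing the columns by their digit tuples removes the numbering of columns from all
  later computations.\<close>

lemma mode_unfolding_gram:
  assumes "n > 0" "r < n" "s < n"
  shows "(mode_unfolding n k T * transpose_mat (mode_unfolding n k T)) $$ (r, s) =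
           (\<Sum>xs | set xs \<subseteq> {1..n} \<and> length xs = k - 1. T (xs @ [r + 1]) * T (xs @ [s + 1]))"
proof -
  have "(mode_unfolding n k T * transpose_mat (mode_unfolding n k T)) $$ (r, s) =
     (\<Sum>c<n ^ (k - 1). T (map (\<lambda>l. c div n ^ l mod n + 1) [0..<k - 1] @ [r + 1]) *
        T (map (\<lambda>l. c div n ^ l mod n + 1) [0..<k - 1] @ [s + 1]))"
    using assms by (subst mult_mat_index_sum[of _ n "n ^ (k - 1)" _ n])
      (auto simp: mode_unfolding_def intro!: sum.cong)
  also have "\<dots> = (\<Sum>xs | set xs \<subseteq> {1..n} \<and> length xs = k - 1. T (xs @ [r + 1]) * T (xs @ [s + 1]))"
    by (rule sum.reindex_bij_betw[OF bij_betw_digits[OF assms(1)]])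
  finally show ?thesis .
qed

section \<open>Counting tuples and edges; entries of the Laplacian\<close>

text \<open>Each m-subset has m! orderings. The binomial form also covers m > card A, where both
  sides vanish; this occurs off the diagonal when n = k.\<close>

lemma card_distinct_lists_binomial:
  assumes "finite A"
  shows "card {xs. length xs = m \<and> distinct xs \<and> set xs \<subseteq> A} = fact m * (card A choose m)"
proof (cases "m \<le> card A")
  case True
  \<comment> \<open>Both sides equal \<open>fact (card A)\<close>; cancelling the common factor
    turns the falling product into the binomial form.\<close>
  have "fact m * (card A choose m) * fact (card A - m) = \<Prod>{card A - m + 1..card A} * fact (card A - m)"
    using binomial_fact_lemma[OF True] fact_div_fact[of "card A - m" "card A"]
    by (metis (no_types, lifting) Suc_eq_plus1 diff_le_self dvd_div_mult_self fact_dvd mult.assoc mult.commute)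
  then show ?thesis using True assms by (simp add: card_lists_distinct_length_eq)
next
  case False
  have "{xs. length xs = m \<and> distinct xs \<and> set xs \<subseteq> A} = {}"
  proof -
    have "m \<le> card A" if "length xs = m" "distinct xs" "set xs \<subseteq> A" for xs
      using that card_mono[OF assms, of "set xs"] by (simp add: distinct_card)
    then show ?thesis using False by blast
  qed
  then show ?thesis using False by (simp only: card.empty) (simp add: binomial_eq_0)
qed

lemma complete_uniform_hypergraph_eq:
  "complete_uniform_hypergraph n k E \<longleftrightarrow> E = {e. e \<subseteq> {1..n} \<and> card e = k}"
  by (auto simp: complete_uniform_hypergraph_def uniform_hypergraph_def)

text \<open>Deleting v maps the edges through v bijectively onto the (k-1)-subsets of the other n -
  1 vertices.\<close>

lemma complete_uniform_hypergraph_degree: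
  assumes "complete_uniform_hypergraph n k E" "k > 0" "v \<in> {1..n}"
  shows "card {e \<in> E. v \<in> e} = (n - 1 choose (k - 1))"
proof -
  have "bij_betw (insert v) {e. e \<subseteq> {1..n} - {v} \<and> card e = k - 1} {e \<in> E. v \<in> e}"
  proof (rule bij_betw_byWitness[where f' = "\<lambda>e. e - {v}"])
    show "insert v ` {e. e \<subseteq> {1..n} - {v} \<and> card e = k - 1} \<subseteq> {e \<in> E. v \<in> e}"
    proof clarify
      fix e assume e: "e \<subseteq> {1..n} - {v}" "card e = k - 1"
      then have "finite e" "v \<notin> e" by (auto intro: finite_subset)
      then show "insert v e \<in> E \<and> v \<in> insert v e"
        using assms e by (auto simp: complete_uniform_hypergraph_eq)
    qed
  qed (use assms in \<open>auto simp: complete_uniform_hypergraph_eq\<close>)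
  then have "card {e \<in> E. v \<in> e} = card {e. e \<subseteq> {1..n} - {v} \<and> card e = k - 1}"
    by (simp add: bij_betw_same_card)
  then show ?thesis
    using assms(3) by (simp add: n_subsets)
qed

text \<open>The last index v is the row of the unfolding and \<open>xs\<close> its column. Any k
  distinct vertices form an edge here, so the edge test reduces to distinctness.\<close>

lemma laplacian_tensor_complete_snoc:
  assumes E: "complete_uniform_hypergraph n k E" and k: "k \<ge> 2" and v: "v \<in> {1..n}"
    and xs: "set xs \<subseteq> {1..n}" "length xs = k - 1"
  shows "laplacian_tensor k E (xs @ [v]) =
           (if xs = replicate (k - 1) v then real (n - 1 choose (k - 1)) else 0)
           - (if distinct xs \<and> v \<notin> set xs then 1 / fact (k - 1) else 0)"
proof -
  obtain m where m: "k = Suc (Suc m)" using k by (metis add_2_eq_Suc le_Suc_ex)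
  have rep: "xs @ [v] = replicate k (hd (xs @ [v])) \<longleftrightarrow> xs = replicate (k - 1) v"
  proof
    assume "xs @ [v] = replicate k (hd (xs @ [v]))"
    then have "xs @ [v] = replicate (k - 1) (hd (xs @ [v])) @ [hd (xs @ [v])]"
      using m by (simp add: replicate_append_same)
    then show "xs = replicate (k - 1) v" by (metis append1_eq_conv)
  qed (use m in \<open>simp add: replicate_append_same\<close>)
  have hd: "hd (xs @ [v]) = v" if "xs = replicate (k - 1) v"
    using that m by simp
  have "distinct (xs @ [v]) \<and> set (xs @ [v]) \<in> E \<longleftrightarrow> distinct xs \<and> v \<notin> set xs"
    using xs v k E by (auto simp: complete_uniform_hypergraph_eq distinct_card)
  then show ?thesis
    unfolding laplacian_tensor_def degree_tensor_def adjacency_tensor_def rep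
    using hd complete_uniform_hypergraph_degree[OF E _ v] k by auto
qed

lemma laplacian_complete_gram:
  assumes E: "complete_uniform_hypergraph n k E" and k: "k \<ge> 3" and nk: "n \<ge> k"
  defines "M \<equiv> mode_unfolding n k (laplacian_tensor k E)"
  shows "M * transpose_mat M = mat n n (\<lambda>(r, s).
     if r = s then real (n - 1 choose (k - 1)) ^ 2 + real (n - 1 choose (k - 1)) / fact (k - 1)
     else real (n - 2 choose (k - 1)) / fact (k - 1))"
    (is "_ = ?R")
proof (rule eq_matI)
  fix r s assume "r < dim_row ?R" "s < dim_col ?R"
  then have rs: "r < n" "s < n" by auto
  define m where "m = k - 1"
  obtain m' where m': "m = Suc (Suc m')"
    using k that[of "k - 3"] by (simp add: m_def)
  define d where "d = real (n - 1 choose m)"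
  define W where "W = {xs. set xs \<subseteq> {1..n} \<and> length xs = m}"
  \<comment> \<open>These tuples are nonzero for the adjacency tensor in both rows. For r = s only
    one vertex is excluded, so diagonal and off-diagonal entries are treated together.\<close>
  define D where "D = {xs. length xs = m \<and> distinct xs \<and> set xs \<subseteq> {1..n} - {r + 1, s + 1}}"
  have finW: "finite W" unfolding W_def by (rule finite_lists_length_eq) simp
  have D: "D = {xs \<in> W. distinct xs \<and> r + 1 \<notin> set xs \<and> s + 1 \<notin> set xs}"
    by (auto simp: D_def W_def)
  have repW: "replicate m (r + 1) \<in> W" using rs by (auto simp: W_def)
  have term_eq: "laplacian_tensor k E (xs @ [r + 1]) * laplacian_tensor k E (xs @ [s + 1]) =
      (if xs = replicate m (r + 1) then (if r = s then d\<^sup>2 else 0) else 0)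
      + (if xs \<in> D then 1 / fact m ^ 2 else 0)" if xs: "xs \<in> W" for xs
  proof -
    \<comment> \<open>Here k \<ge> 3 enters through m \<ge> 2: a constant tuple is not distinct, so
      the mixed products of degree and adjacency entries vanish. Degree entries of two rows meet in
      one column only if the rows agree.\<close>
    have *: "m \<noteq> 0" "\<not> distinct (replicate m v)" "replicate m v = replicate m w \<longleftrightarrow> v = w" for v w :: nat
      using m' by auto
    have "laplacian_tensor k E (xs @ [v]) = (if xs = replicate m v then d else 0)
        - (if distinct xs \<and> v \<notin> set xs then 1 / fact m else 0)" if "v \<in> {1..n}" for v
      using laplacian_tensor_complete_snoc[OF E _ that, of xs] xs k by (simp add: W_def m_def d_def)
    moreover have "r + 1 \<in> {1..n}" "s + 1 \<in> {1..n}" using rs by auto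
    ultimately show ?thesis
      using xs unfolding D by (auto simp: * power2_eq_square)
  qed
  have "(M * transpose_mat M) $$ (r, s) = (\<Sum>xs\<in>W. laplacian_tensor k E (xs @ [r + 1]) * laplacian_tensor k E (xs @ [s + 1]))"
    unfolding M_def W_def m_def using rs by (intro mode_unfolding_gram) auto
  also have "\<dots> = (\<Sum>xs\<in>W. (if xs = replicate m (r + 1) then (if r = s then d\<^sup>2 else 0) else 0)
      + (if xs \<in> D then 1 / fact m ^ 2 else 0))"
    by (rule sum.cong[OF refl term_eq])
  also have "\<dots> = (if r = s then d\<^sup>2 else 0) + real (card D) / fact m ^ 2"
  proof -
    have "W \<inter> D = D" using D by blast
    then show ?thesis
      using repW unfolding sum.distrib sum.delta[OF finW]
        sum.inter_restrict[OF finW, symmetric] by (simp add: power_one_over)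
  qed
  \<comment> \<open>The factor m! cancels one of the two in the squared adjacency weight, leaving a
    binomial coefficient over (k-1)!.\<close>
  also have "card D = fact m * ((if r = s then n - 1 else n - 2) choose m)"
  proof -
    have "card ({1..n} - {r + 1, s + 1}) = (if r = s then n - 1 else n - 2)"
      using rs by (auto simp: card_Diff_subset)
    then show ?thesis by (simp add: D_def card_distinct_lists_binomial)
  qed
  finally show "(M * transpose_mat M) $$ (r, s) = ?R $$ (r, s)"
    using rs by (simp add: m_def d_def power2_eq_square)
qed (simp_all add: M_def mode_unfolding_def)

section \<open>Translation into Gamma values\<close>

lemma Gamma_of_nat_diff:
  assumes "j < n"
  shows "Gamma (real n - real j) = fact (n - j - 1)"
proof -
  have "real n - real j = 1 + real (n - j - 1)" using assms by (simp add: of_nat_diff)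
  then show ?thesis by (simp only: Gamma_fact)
qed

lemma diagonal_entry_Gamma:
  assumes "1 \<le> k" "k \<le> n"
  shows "Gamma (real n) * (Gamma (real n - real k + 1) + Gamma (real n))
           / (Gamma (real k) ^ 2 * Gamma (real n - real k + 1) ^ 2)
         = real (n - 1 choose (k - 1)) ^ 2 + real (n - 1 choose (k - 1)) / fact (k - 1)"
proof -
  have G: "Gamma (real n) = fact (n - 1)" "Gamma (real k) = fact (k - 1)"
    "Gamma (real n - real k + 1) = fact (n - k)"
    using assms Gamma_of_nat_diff[of 0 n] Gamma_of_nat_diff[of 0 k] Gamma_of_nat_diff[of "k - 1" n]
    by (simp_all add: of_nat_diff algebra_simps)
  have B: "real (n - 1 choose (k - 1)) = fact (n - 1) / (fact (k - 1) * fact (n - k))"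
    using binomial_fact[where 'a = real, of "k - 1" "n - 1"] assms by simp
  show ?thesis unfolding G B by (simp add: field_simps power2_eq_square)
qed

lemma off_diagonal_entry_Gamma:
  assumes "2 \<le> k" "k \<le> n"
  shows "Gamma (real n - 1) / (Gamma (real k) ^ 2 * Gamma (real n - real k))
         = real (n - 2 choose (k - 1)) / fact (k - 1)"
proof (cases "k = n")
  case True
  \<comment> \<open>For n = k the left side is 0 because \<open>Gamma 0\<close> is 0 and division by
    0 gives 0; the right side is 0 because n - 2 < k - 1.\<close>
  then show ?thesis using assms by (simp add: binomial_eq_0)
next
  case False
  then have G: "Gamma (real n - 1) = fact (n - 2)" "Gamma (real k) = fact (k - 1)"
    "Gamma (real n - real k) = fact (n - k - 1)"
    using assms Gamma_of_nat_diff[of 1 n] Gamma_of_nat_diff[of 0 k] Gamma_of_nat_diff[of k n]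
    by (simp_all add: numeral_2_eq_2)
  have "n - 2 - (k - 1) = n - k - 1" using assms by simp
  then have B: "real (n - 2 choose (k - 1)) = fact (n - 2) / (fact (k - 1) * fact (n - k - 1))"
    using binomial_fact[where 'a = real, of "k - 1" "n - 2"] assms False by simp
  show ?thesis unfolding G B by (simp add: field_simps power2_eq_square)
qed

section \<open>The entropy formula\<close>

theorem proposition4:
  fixes n k :: nat and E :: "nat set set" and \<alpha> \<beta> :: real
  assumes "k \<ge> 3" and "n \<ge> k"
    and "complete_uniform_hypergraph n k E"
    and "\<alpha> = sqrt (Gamma (real n) * (Gamma (real n - real k + 1) + Gamma (real n))
                    / (Gamma (real k) ^ 2 * Gamma (real n - real k + 1) ^ 2)
                  - Gamma (real n - 1) / (Gamma (real k) ^ 2 * Gamma (real n - real k)))"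
    and "\<beta> = sqrt (Gamma (real n) * (Gamma (real n - real k + 1) + Gamma (real n))
                    / (Gamma (real k) ^ 2 * Gamma (real n - real k + 1) ^ 2)
                  + (real n - 1) * Gamma (real n - 1)
                    / (Gamma (real k) ^ 2 * Gamma (real n - real k)))"
  shows "tensor_entropy n k E =
           (1 - real n) * \<alpha> / ((real n - 1) * \<alpha> + \<beta>) * ln (\<alpha> / ((real n - 1) * \<alpha> + \<beta>))
           - \<beta> / ((real n - 1) * \<alpha> + \<beta>) * ln (\<beta> / ((real n - 1) * \<alpha> + \<beta>))"
proof -
  define a where "a = real (n - 1 choose (k - 1)) ^ 2 + real (n - 1 choose (k - 1)) / fact (k - 1)"
  define b where "b = real (n - 2 choose (k - 1)) / fact (k - 1)"
  define \<gamma> where "\<gamma> = singular_values (mode_unfolding n k (laplacian_tensor k E))"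
  have kn: "1 \<le> k" "2 \<le> k" "0 < n" using assms by auto
  \<comment> \<open>\<alpha> and \<beta> are thus the square roots of the two Gram eigenvalues;
    \<beta> belongs to the all-ones vector.\<close>
  have "\<alpha> = sqrt (a - b)" "\<beta> = sqrt (a + (real n - 1) * b)"
    unfolding assms(4,5) a_def b_def diagonal_entry_Gamma[OF kn(1) assms(2), symmetric]
      off_diagonal_entry_Gamma[OF kn(2) assms(2), symmetric] by simp_all
  then have \<gamma>: "\<gamma> = add_mset \<beta> (replicate_mset (n - 1) \<alpha>)"
    using singular_values_const_diag_off_diag[OF kn(3) laplacian_complete_gram[OF assms(3,1,2)]]
    by (simp add: \<gamma>_def a_def b_def)
  have sum: "sum_mset \<gamma> = (real n - 1) * \<alpha> + \<beta>"
    using kn by (simp add: \<gamma> sum_mset_replicate_mset of_nat_diff)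
  show ?thesis
    \<comment> \<open>The n - 1 copies of \<alpha> give equal summands, and the outer minus sign
      turns their number into the factor 1 - n.\<close>
    unfolding tensor_entropy_def Let_def \<gamma>_def[symmetric] sum
    using kn by (simp add: \<gamma> image_replicate_mset sum_mset_replicate_mset of_nat_diff
        algebra_simps diff_divide_distrib)
qed

end
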